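(* Let $n\in\mathbb N$, $R_0>0$, $a_1,\dots,a_n\in\mathcal B:=B(0,R_0)\subset\mathbb R^2$ and $v_1,\dots,v_n>0$. Let $\lambda>1$ be such that $(\lambda^2-1)\pi R_0^2=\sum_{i=1}^n v_i$. Set $$\sigma=\min\left\{\min_i\frac{\left(1-\frac{|a_i|}{R_0}\right)^2}{\frac{v_i}{\sum_k v_k}},\ \min_{i\ne j}\frac{|a_i-a_j|^2}{R_0^2\left(\sqrt{\frac{v_i}{\sum_k v_k}}+\sqrt{\frac{v_j}{\sum_k v_k}}\right)^2}\right\}.$$ Then, both in the case $\sigma\ge1$ and in the case where $\sigma<1$ and $\lambda^2<\frac1{1-\sigma}$, the configuration $\big((a_i)_{i=1}^n,(v_i)_{i=1}^n\big)$ is attainable through an evolution of circular cavities.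
   Context: $B(x,r)$ is the open disk of centre $x$ and radius $r$, and $\overline{B(x,0)}=\{x\}$. A minimum over an empty index set is $+\infty$. The configuration $\big((a_i)_{i=1}^n,(v_i)_{i=1}^n\big)$ is attainable through an evolution of circular cavities in $\mathcal B=B(0,R_0)$ if $a_i\in\mathcal B$ and $v_i>0$ for all $i$ and, with $\lambda$ given by $\sum_{i=1}^n v_i=(\lambda^2-1)\pi R_0^2$, there exist $z_i\in C^1([1,\lambda],\mathbb R^2)$ and $L_i:[1,\lambda]\to[0,\infty)$, $i=1,\dots,n$, such that $\sum_{i=1}^n\pi L_i^2(t)=(t^2-1)\pi R_0^2$ for all $t\in[1,\lambda]$ and, for each $i$: (i) $L_i^2\in C^1([1,\lambda],[0,\infty))$; (ii) $z_i(1)=a_i$ and $L_i(1)=0$; (iii) $\pi L_i^2(\lambda)=v_i$; (iv) for all $t\in[1,\lambda]$ the disks $\overline{B(z_i(t),L_i(t))}$ are disjoint and contained in $B(0,tR_0)$. *)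

theory Defs
  imports "HOL-Analysis.Analysis"
begin

text \<open>
  Continuous differentiability on a set, with derivatives taken within the set (hence one-sided at
  the end points of an interval). The library's \<open>C1_differentiable_on\<close> asks for two-sided derivatives
  of a total function, which is too strong below: a square \<open>L\<^sup>2\<close> with \<open>L 1 = 0\<close> has a minimum at 1,
  so its two-sided derivative there could only be 0, against the area identity.
\<close>

definition C1_within :: "real set \<Rightarrow> (real \<Rightarrow> 'a::real_normed_vector) \<Rightarrow> bool" where
  "C1_within S f \<longleftrightarrow>
     (\<exists>f'. (\<forall>t\<in>S. (f has_vector_derivative f' t) (at t within S)) \<and> continuous_on S f')"

text \<open>
  The condition \<open>lam \<ge> 1\<close> selects the root of the area equation for which \<open>[1, lam]\<close> is an interval.
  Since \<open>L i t \<ge> 0\<close>, \<open>cball (z i t) (L i t)\<close> is the closure of the open disk, and the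
  singleton of the centre when \<open>L i t = 0\<close>.
\<close>

definition attainable :: "real \<Rightarrow> nat \<Rightarrow> (nat \<Rightarrow> real^2) \<Rightarrow> (nat \<Rightarrow> real) \<Rightarrow> bool" where
  "attainable R\<^sub>0 n a v \<longleftrightarrow>
     (\<forall>i\<in>{1..n}. a i \<in> ball 0 R\<^sub>0 \<and> v i > 0) \<and>
     (\<exists>lam\<ge>1. (\<Sum>i=1..n. v i) = (lam\<^sup>2 - 1) * pi * R\<^sub>0\<^sup>2 \<and>
       (\<exists>(z :: nat \<Rightarrow> real \<Rightarrow> real^2) (L :: nat \<Rightarrow> real \<Rightarrow> real).
          (\<forall>i\<in>{1..n}. C1_within {1..lam} (z i)) \<and>
          (\<forall>i\<in>{1..n}. \<forall>t\<in>{1..lam}. L i t \<ge> 0) \<and>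
          (\<forall>t\<in>{1..lam}. (\<Sum>i=1..n. pi * (L i t)\<^sup>2) = (t\<^sup>2 - 1) * pi * R\<^sub>0\<^sup>2) \<and>
          (\<forall>i\<in>{1..n}. C1_within {1..lam} (\<lambda>t. (L i t)\<^sup>2)) \<and>
          (\<forall>i\<in>{1..n}. z i 1 = a i \<and> L i 1 = 0) \<and>
          (\<forall>i\<in>{1..n}. pi * (L i lam)\<^sup>2 = v i) \<and>
          (\<forall>t\<in>{1..lam}. disjoint_family_on (\<lambda>i. cball (z i t) (L i t)) {1..n} \<and>
             (\<forall>i\<in>{1..n}. cball (z i t) (L i t) \<subseteq> ball 0 (t * R\<^sub>0)))))"

text \<open>
  Extended reals, so that the second infimum is \<open>\<infinity>\<close> when \<open>n = 1\<close>; all index sets are finite, so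
  nonempty infima are minima.
\<close>

definition sigma_min :: "real \<Rightarrow> nat \<Rightarrow> (nat \<Rightarrow> real^2) \<Rightarrow> (nat \<Rightarrow> real) \<Rightarrow> ereal" where
  "sigma_min R\<^sub>0 n a v =
     min (INF i\<in>{1..n}. ereal ((1 - norm (a i) / R\<^sub>0)\<^sup>2 / (v i / (\<Sum>k=1..n. v k))))
         (INF (i, j)\<in>{(i, j). i \<in> {1..n} \<and> j \<in> {1..n} \<and> i \<noteq> j}.
            ereal ((norm (a i - a j))\<^sup>2 /
              (R\<^sub>0\<^sup>2 * (sqrt (v i / (\<Sum>k=1..n. v k)) + sqrt (v j / (\<Sum>k=1..n. v k)))\<^sup>2)))"

end

theory Submission imports Defs begin

text \<open>
  Let the centres follow the homogeneous dilation of the domain, \<open>z\<^sub>i(t) = t a\<^sub>i\<close>, and let every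
  cavity take a constant share \<open>w\<^sub>i = v\<^sub>i / \<Sum> v\<^sub>k\<close> of the area created so far,
  \<open>L\<^sub>i(t)\<^sup>2 = (t\<^sup>2 - 1) w\<^sub>i R\<^sub>0\<^sup>2\<close>. The area identity and the end conditions then hold because the
  shares add up to 1. After division by \<open>t\<close>, the centres stand still at \<open>a\<^sub>i\<close> in the fixed disk of
  radius \<open>R\<^sub>0\<close>, while all squared radii carry the common increasing factor \<open>1 - 1/t\<^sup>2\<close>. A disk
  touches the boundary, or two disks touch each other, exactly when this factor reaches the
  corresponding term in the minimum \<open>\<sigma>\<close>. So the evolution is admissible as long as
  \<open>1 - 1/t\<^sup>2 < \<sigma>\<close>, which is automatic for \<open>\<sigma> \<ge> 1\<close> and otherwise says \<open>t\<^sup>2 < 1 / (1 - \<sigma>)\<close>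
  (\<open>growth_factor_less\<close>). The lemma \<open>scaled_radius_less\<close> turns this bound on the factor into the
  inequality between radii and distances that containment and disjointness need.
\<close>

text \<open>
  The hypothesis on \<open>\<sigma>\<close> says \<open>1 - 1/lam\<^sup>2 < \<sigma>\<close>, and the left side increases with \<open>lam\<close>. The
  conclusion speaks of a real \<open>x\<close> above \<open>\<sigma>\<close> because it is applied to the single terms of the
  minimum, which are real even where \<open>\<sigma>\<close> is only known as an extended real.
\<close>

lemma growth_factor_less:
  fixes \<sigma> :: ereal and lam t x :: real
  assumes "1 \<le> t" "t \<le> lam"
    and "\<sigma> \<ge> 1 \<or> (\<sigma> < 1 \<and> ereal (lam\<^sup>2) < 1 / (1 - \<sigma>))"
    and "\<sigma> \<le> ereal x"
  shows "t\<^sup>2 - 1 < x * t\<^sup>2"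
proof (cases "1 \<le> x")
  case True
  have "1 * t\<^sup>2 \<le> x * t\<^sup>2" using True by (intro mult_right_mono) auto
  then show ?thesis by simp
next
  case False
  have "\<not> \<sigma> \<ge> 1"
  proof
    assume "\<sigma> \<ge> 1"
    then have "1 \<le> ereal x" using assms(4) by (rule order_trans)
    then show False using False by simp
  qed
  then have lt: "ereal (lam\<^sup>2) < 1 / (1 - \<sigma>)" using assms(3) by simp
  show ?thesis
  proof (cases \<sigma>)
    case (real s)
    have s: "s \<le> x" "s < 1" using assms(4) False real by auto
    have "lam\<^sup>2 < 1 / (1 - s)"
      using lt s real by (simp add: one_ereal_def)
    then have "lam\<^sup>2 * (1 - s) < 1" using s by (simp add: field_simps)
    moreover have "t\<^sup>2 * (1 - x) \<le> lam\<^sup>2 * (1 - s)"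
      using assms(1,2) s False by (intro mult_mono power_mono) auto
    ultimately show ?thesis by (simp add: algebra_simps)
  next
    case PInf
    then show ?thesis using assms(4) by simp
  next
    case MInf
    then have "lam\<^sup>2 < 0" using lt by (simp add: one_ereal_def)
    then show ?thesis by simp
  qed
qed

lemma scaled_radius_less:
  fixes t d s :: real
  assumes "1 \<le> t" "0 \<le> d" "0 < s" "t\<^sup>2 - 1 < d\<^sup>2 / s\<^sup>2 * t\<^sup>2"
  shows "sqrt (t\<^sup>2 - 1) * s < t * d"
proof (rule power_less_imp_less_base)
  have "0 \<le> t\<^sup>2 - 1" using assms(1) by simp
  then have "(sqrt (t\<^sup>2 - 1) * s)\<^sup>2 = (t\<^sup>2 - 1) * s\<^sup>2" by (simp add: power_mult_distrib)
  also have "\<dots> < (d\<^sup>2 / s\<^sup>2 * t\<^sup>2) * s\<^sup>2" using assms by (intro mult_strict_right_mono) auto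
  also have "\<dots> = (t * d)\<^sup>2" using assms(3) by (simp add: power_mult_distrib)
  finally show "(sqrt (t\<^sup>2 - 1) * s)\<^sup>2 < (t * d)\<^sup>2" .
qed (use assms in simp)

lemma sigma_min_le_boundary:
  assumes "i \<in> {1..n}"
  shows "sigma_min R n a v \<le> ereal ((1 - norm (a i) / R)\<^sup>2 / (v i / (\<Sum>k=1..n. v k)))"
  unfolding sigma_min_def by (rule min.coboundedI1) (rule INF_lower[OF assms])

lemma sigma_min_le_pair:
  assumes "i \<in> {1..n}" "j \<in> {1..n}" "i \<noteq> j"
  shows "sigma_min R n a v \<le> ereal ((norm (a i - a j))\<^sup>2 /
    (R\<^sup>2 * (sqrt (v i / (\<Sum>k=1..n. v k)) + sqrt (v j / (\<Sum>k=1..n. v k)))\<^sup>2))"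
  unfolding sigma_min_def
  by (rule min.coboundedI2, rule INF_lower2[of "(i, j)"]) (use assms in auto)

lemma cball_subset_ball_zero:
  fixes x :: "'a::real_normed_vector"
  assumes "norm x + r < s"
  shows "cball x r \<subseteq> ball 0 s"
proof
  fix y assume "y \<in> cball x r"
  then have "norm (y - x) \<le> r" by (simp add: dist_norm norm_minus_commute)
  then show "y \<in> ball 0 s" using assms norm_triangle_ineq[of "y - x" x] by simp
qed

lemma disjoint_cballs:
  fixes x y :: "'a::metric_space"
  assumes "r + s < dist x y"
  shows "cball x r \<inter> cball y s = {}"
proof (rule ccontr)
  assume "cball x r \<inter> cball y s \<noteq> {}"
  then obtain p where "dist x p \<le> r" "dist y p \<le> s" by auto
  then show False using assms dist_triangle2[of x y p] by linarith
qed

theorem proposition1p1: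
  fixes n :: nat and R\<^sub>0 :: real and a :: "nat \<Rightarrow> real^2" and v :: "nat \<Rightarrow> real"
    and lam :: real and \<sigma> :: ereal
  assumes "R\<^sub>0 > 0"
    and "\<forall>i\<in>{1..n}. a i \<in> ball 0 R\<^sub>0"
    and "\<forall>i\<in>{1..n}. v i > 0"
    and "lam > 1"
    and "(lam\<^sup>2 - 1) * pi * R\<^sub>0\<^sup>2 = (\<Sum>i=1..n. v i)"
    and "\<sigma> = sigma_min R\<^sub>0 n a v"
    and "\<sigma> \<ge> 1 \<or> (\<sigma> < 1 \<and> ereal (lam\<^sup>2) < 1 / (1 - \<sigma>))"
  shows "attainable R\<^sub>0 n a v"
proof -
  define V where "V = (\<Sum>k=1..n. v k)"
  define w where "w i = v i / V" for i
  define z where "z i t = t *\<^sub>R a i" for i and t :: real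
  define L where "L i t = sqrt (t\<^sup>2 - 1) * (R\<^sub>0 * sqrt (w i))" for i and t :: real
  have "1 < lam\<^sup>2" using assms(4) by (simp add: one_less_power)
  then have V_pos: "V > 0" using assms(1,5) unfolding V_def by (metis diff_gt_0_iff_gt
    mult_pos_pos pi_gt_zero zero_less_power)
  have w_pos: "w i > 0" if "i \<in> {1..n}" for i
    using assms(3) that V_pos by (simp add: w_def)
  have w_sum: "(\<Sum>i=1..n. w i) = 1"
    using V_pos by (simp add: w_def V_def flip: sum_divide_distrib)
  have L_sq: "(L i t)\<^sup>2 = (t\<^sup>2 - 1) * (R\<^sub>0\<^sup>2 * w i)" if "i \<in> {1..n}" "1 \<le> t" for i t
    using that w_pos[OF that(1)] by (simp add: L_def power_mult_distrib)

  have z_C1: "C1_within {1..lam} (z i)" for i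
    unfolding C1_within_def
  proof (intro exI conjI ballI)
    show "(z i has_vector_derivative a i) (at t within {1..lam})" for t
      unfolding z_def by (auto intro!: derivative_eq_intros)
    show "continuous_on {1..lam} (\<lambda>t. a i)" by simp
  qed
  have L_C1: "C1_within {1..lam} (\<lambda>t. (L i t)\<^sup>2)" if i: "i \<in> {1..n}" for i
    unfolding C1_within_def
  proof (intro exI conjI ballI)
    fix t assume t: "t \<in> {1..lam}"
    have "((\<lambda>t. (t\<^sup>2 - 1) * (R\<^sub>0\<^sup>2 * w i)) has_vector_derivative 2 * t * (R\<^sub>0\<^sup>2 * w i))
        (at t within {1..lam})"
      by (auto intro!: derivative_eq_intros simp flip: has_real_derivative_iff_has_vector_derivative)
    then show "((\<lambda>t. (L i t)\<^sup>2) has_vector_derivative 2 * t * (R\<^sub>0\<^sup>2 * w i))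
        (at t within {1..lam})"
      by (rule has_vector_derivative_transform[OF t, rotated]) (simp add: L_sq[OF i])
  next
    show "continuous_on {1..lam} (\<lambda>t. 2 * t * (R\<^sub>0\<^sup>2 * w i))" by (intro continuous_intros)
  qed

  have area: "(\<Sum>i=1..n. pi * (L i t)\<^sup>2) = (t\<^sup>2 - 1) * pi * R\<^sub>0\<^sup>2" if "1 \<le> t" for t
  proof -
    have "(\<Sum>i=1..n. pi * (L i t)\<^sup>2) = (\<Sum>i=1..n. (t\<^sup>2 - 1) * pi * R\<^sub>0\<^sup>2 * w i)"
      using that by (intro sum.cong) (simp_all add: L_sq)
    also have "\<dots> = (t\<^sup>2 - 1) * pi * R\<^sub>0\<^sup>2" by (simp only: w_sum mult_1_right flip: sum_distrib_left)
    finally show ?thesis .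
  qed
  have final_area: "pi * (L i lam)\<^sup>2 = v i" if "i \<in> {1..n}" for i
  proof -
    have "pi * (L i lam)\<^sup>2 = ((lam\<^sup>2 - 1) * pi * R\<^sub>0\<^sup>2) * w i"
      using that assms(4) by (simp add: L_sq)
    also have "\<dots> = V * w i" using assms(5) by (simp add: V_def)
    also have "\<dots> = v i" using V_pos by (simp add: w_def)
    finally show ?thesis .
  qed

  have inside: "cball (z i t) (L i t) \<subseteq> ball 0 (t * R\<^sub>0)"
    if i: "i \<in> {1..n}" and t: "1 \<le> t" "t \<le> lam" for i t
  proof (rule cball_subset_ball_zero)
    define d where "d = 1 - norm (a i) / R\<^sub>0"
    have "d \<ge> 0" using assms(1,2) i by (auto simp: d_def less_imp_le)
    have "\<sigma> \<le> ereal (d\<^sup>2 / (sqrt (w i))\<^sup>2)"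
      using sigma_min_le_boundary[OF i] w_pos[OF i] assms(6) by (simp add: d_def w_def V_def)
    then have "t\<^sup>2 - 1 < d\<^sup>2 / (sqrt (w i))\<^sup>2 * t\<^sup>2" by (rule growth_factor_less[OF t assms(7)])
    then have "sqrt (t\<^sup>2 - 1) * sqrt (w i) < t * d"
      using t \<open>d \<ge> 0\<close> w_pos[OF i] by (intro scaled_radius_less) auto
    then have "(sqrt (t\<^sup>2 - 1) * sqrt (w i)) * R\<^sub>0 < (t * d) * R\<^sub>0"
      using assms(1) by (rule mult_strict_right_mono)
    moreover have "(t * d) * R\<^sub>0 = t * R\<^sub>0 - t * norm (a i)"
      using assms(1) by (simp add: d_def field_simps)
    ultimately show "norm (z i t) + L i t < t * R\<^sub>0"
      using t by (simp add: z_def L_def mult_ac)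
  qed
  have disjoint: "cball (z i t) (L i t) \<inter> cball (z j t) (L j t) = {}"
    if ij: "i \<in> {1..n}" "j \<in> {1..n}" "i \<noteq> j" and t: "1 \<le> t" "t \<le> lam" for i j t
  proof (rule disjoint_cballs)
    define s where "s = R\<^sub>0 * (sqrt (w i) + sqrt (w j))"
    have "s > 0" using assms(1) w_pos[OF ij(1)] w_pos[OF ij(2)] by (simp add: s_def add_pos_pos)
    have "\<sigma> \<le> ereal ((norm (a i - a j))\<^sup>2 / s\<^sup>2)"
      using sigma_min_le_pair[OF ij] assms(6) by (simp add: s_def w_def V_def power_mult_distrib)
    then have "t\<^sup>2 - 1 < (norm (a i - a j))\<^sup>2 / s\<^sup>2 * t\<^sup>2"
      by (rule growth_factor_less[OF t assms(7)])
    then have "sqrt (t\<^sup>2 - 1) * s < t * norm (a i - a j)"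
      using t \<open>s > 0\<close> by (intro scaled_radius_less) auto
    also have "\<dots> = dist (z i t) (z j t)"
      using t by (simp add: z_def dist_norm flip: scaleR_diff_right)
    finally show "L i t + L j t < dist (z i t) (z j t)"
      by (simp add: L_def s_def algebra_simps)
  qed

  show ?thesis
    unfolding attainable_def
  proof (intro conjI exI[of _ lam] exI[of _ z] exI[of _ L] ballI)
    show "(\<Sum>i=1..n. v i) = (lam\<^sup>2 - 1) * pi * R\<^sub>0\<^sup>2" using assms(5) by simp
    show "L i t \<ge> 0" if "i \<in> {1..n}" "t \<in> {1..lam}" for i t
      using that assms(1) w_pos[OF that(1)] by (simp add: L_def)
    show "disjoint_family_on (\<lambda>i. cball (z i t) (L i t)) {1..n}" if "t \<in> {1..lam}" for t
      using that disjoint by (simp add: disjoint_family_on_def)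
  qed (use assms z_C1 L_C1 area final_area inside in \<open>auto simp: z_def L_def\<close>)
qed

end
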